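(* For each $n\in N$ let $\mathcal{D}_n$ be a coherent set of desirable gambles on $\mathcal{X}_n$. Then $\otimes_{n\in N}\mathcal{D}_n$ is independent: for all disjoint subsets $I$ and $O$ of $N$, and all $x_I\in\mathcal{X}_I$, $$\mathrm{marg}_O\big((\otimes_{n\in N}\mathcal{D}_n)\rfloor x_I\big)=\mathrm{marg}_O(\otimes_{n\in N}\mathcal{D}_n)=\otimes_{o\in O}\mathcal{D}_o .$$
   Context: Let $N$ be a finite non-empty index set, and for each $n\in N$ let $\mathcal{X}_n$ be a finite non-empty set. For $R\subseteq N$ let $\mathcal{X}_R:=\prod_{r\in R}\mathcal{X}_r$, with $\mathcal{X}_\emptyset$ a one-point set. Subsets of $N$ are allowed to be empty. For a finite non-empty set $\mathcal{Z}$, a gamble on $\mathcal{Z}$ is a function $\mathcal{Z}\to\mathbb{R}$; $\mathcal{G}(\mathcal{Z})$ is the linear space of all gambles on $\mathcal{Z}$. Write $f\geq g$ for pointwise inequality and $f>g$ if $f\geq g$ and $f\neq g$; $\mathcal{G}(\mathcal{Z})_{>0}:=\{f\in\mathcal{G}(\mathcal{Z}):f>0\}$. For $\mathcal{A}\subseteq\mathcal{G}(\mathcal{Z})$, $\mathrm{posi}(\mathcal{A}):=\{\sum_{k=1}^{m}\lambda_kf_k : m\geq 1,\ f_k\in\mathcal{A},\ \lambda_k>0\}$. A set of desirable gambles $\mathcal{D}\subseteq\mathcal{G}(\mathcal{Z})$ is coherent if (D1) $0\notin\mathcal{D}$; (D2) $\mathcal{G}(\mathcal{Z})_{>0}\subseteq\mathcal{D}$;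 (D3) $\mathrm{posi}(\mathcal{D})=\mathcal{D}$. For $R\subseteq S\subseteq N$, a gamble $f$ on $\mathcal{X}_R$ is identified with its cylindrical extension $x_S\mapsto f(x_R)$ on $\mathcal{X}_S$; $\mathbb{I}_{\{x_R\}}$ denotes the indicator of $x_R\in\mathcal{X}_R$ (identified in the same way with a gamble on $\mathcal{X}_S$). Marginalisation: for $O\subseteq S\subseteq N$ and $\mathcal{D}\subseteq\mathcal{G}(\mathcal{X}_S)$, $\mathrm{marg}_O(\mathcal{D}):=\mathcal{D}\cap\mathcal{G}(\mathcal{X}_O)$. Conditioning: for $I\subseteq S\subseteq N$, $\mathcal{D}\subseteq\mathcal{G}(\mathcal{X}_S)$ and $x_I\in\mathcal{X}_I$, $\mathcal{D}\rfloor x_I:=\{g\in\mathcal{G}(\mathcal{X}_{S\setminus I}):\mathbb{I}_{\{x_I\}}g\in\mathcal{D}\}$. For $R\subseteq N$ and coherent $\mathcal{D}_r\subseteq\mathcal{G}(\mathcal{X}_r)$, $r\in R$, define $$\otimes_{r\in R}\mathcal{D}_r:=\mathrm{posi}\Big(\mathcal{G}(\mathcal{X}_R)_{>0}\cup\bigcup_{r\in R}\mathrm{posi}\left(\{\mathbb{I}_{\{x_{R\setminus\{r\}}\}}g : g\in\mathcal{D}_r,\ x_{R\setminus\{r\}}\in\mathcal{X}_{R\setminus\{r\}}\}\right)\Big)$$ (for $R=\emptyset$ this is $\mathcal{G}(\mathcal{X}_\emptyset)_{>0}$). *)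

theory Defs
  imports Complex_Main "HOL-Library.FuncSet" "HOL-Library.Indicator_Function"
begin

(* Possibility spaces are sets, and a gamble on Z is represented by the unique total
   function that agrees with it on Z and is 0 outside Z. Under this convention sums, scalar
   multiples and products of gambles on Z are the pointwise ones, the zero gamble is
   "\<lambda>_. 0", and the pointwise order of the function type is the pointwise order on Z. *)

definition gambles :: "'z set \<Rightarrow> ('z \<Rightarrow> real) set" where
  "gambles Z = {f. \<forall>z. z \<notin> Z \<longrightarrow> f z = 0}"

definition pos_gambles :: "'z set \<Rightarrow> ('z \<Rightarrow> real) set" where
  "pos_gambles Z = {f \<in> gambles Z. f > (\<lambda>_. 0)}"

definition posi :: "('z \<Rightarrow> real) set \<Rightarrow> ('z \<Rightarrow> real) set" where
  "posi A = {\<lambda>z. \<Sum>k=1..m. c k * f k z | m (c :: nat \<Rightarrow> real) f.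
     m \<ge> 1 \<and> (\<forall>k\<in>{1..m}. f k \<in> A \<and> c k > 0)}"

definition coherent :: "'z set \<Rightarrow> ('z \<Rightarrow> real) set \<Rightarrow> bool" where
  "coherent Z D \<longleftrightarrow>
     D \<subseteq> gambles Z \<and> (\<lambda>_. 0) \<notin> D \<and> pos_gambles Z \<subseteq> D \<and> posi D = D"

(* The product of the X r over r in R is "Pi\<^sub>E R X", whose elements are undefined outside
   R; so "Pi\<^sub>E {} X" has exactly one point, and x_R is "restrict x R". The identification of
   a gamble with its cylindrical extension is made explicit by the two maps below: cyl takes
   a gamble on the product over R to one on the product over S, and cyl1 takes a gamble on
   the single factor X r to one on the product over S. *)

definition cyl :: "('n \<Rightarrow> 'a set) \<Rightarrow> 'n set \<Rightarrow> 'n set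
    \<Rightarrow> (('n \<Rightarrow> 'a) \<Rightarrow> real) \<Rightarrow> ('n \<Rightarrow> 'a) \<Rightarrow> real" where
  "cyl X R S f = (\<lambda>x. if x \<in> Pi\<^sub>E S X then f (restrict x R) else 0)"

definition cyl1 :: "('n \<Rightarrow> 'a set) \<Rightarrow> 'n \<Rightarrow> 'n set
    \<Rightarrow> ('a \<Rightarrow> real) \<Rightarrow> ('n \<Rightarrow> 'a) \<Rightarrow> real" where
  "cyl1 X r S g = (\<lambda>x. if x \<in> Pi\<^sub>E S X then g (x r) else 0)"

(* In marg and cond, S is the index set on whose product D lives: D is a set of gambles on
   "Pi\<^sub>E S X". The results are sets of gambles on the products over J and over S - I. *)

definition marg :: "('n \<Rightarrow> 'a set) \<Rightarrow> 'n set \<Rightarrow> 'n set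
    \<Rightarrow> (('n \<Rightarrow> 'a) \<Rightarrow> real) set \<Rightarrow> (('n \<Rightarrow> 'a) \<Rightarrow> real) set" where
  "marg X S J D = {f \<in> gambles (Pi\<^sub>E J X). cyl X J S f \<in> D}"

definition cond :: "('n \<Rightarrow> 'a set) \<Rightarrow> 'n set \<Rightarrow> 'n set
    \<Rightarrow> (('n \<Rightarrow> 'a) \<Rightarrow> real) set \<Rightarrow> ('n \<Rightarrow> 'a) \<Rightarrow> (('n \<Rightarrow> 'a) \<Rightarrow> real) set" where
  "cond X S I D xI = {g \<in> gambles (Pi\<^sub>E (S - I) X).
     (\<lambda>x. cyl X I S (indicator {xI}) x * cyl X (S - I) S g x) \<in> D}"

definition ind_prod :: "('n \<Rightarrow> 'a set) \<Rightarrow> 'n set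
    \<Rightarrow> ('n \<Rightarrow> ('a \<Rightarrow> real) set) \<Rightarrow> (('n \<Rightarrow> 'a) \<Rightarrow> real) set" where
  "ind_prod X R D = posi (pos_gambles (Pi\<^sub>E R X) \<union>
     (\<Union>r\<in>R. posi {\<lambda>x. cyl X (R - {r}) R (indicator {y}) x * cyl1 X r R g x | g y.
        g \<in> D r \<and> y \<in> Pi\<^sub>E (R - {r}) X}))"

end

theory Submission
  imports Defs
begin

(* The inclusions from right to left hold because the indicator of x_I times a generator of the
   product over O is a sum of generators of the product over N. For the converse, an element of
   the product over N involves only finitely many gambles of each D n, and by a theorem of the
   alternative there are strictly positive weights on X n under which all of these have positive
   expectation. Averaging out the coordinates outside O with these weights is linear, sends the
   generators involved into the product over O, and sends the indicator of x_I times f to a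
   positive multiple of f. *)

section \<open>Positive hulls and positive gambles\<close>

lemma posi_base: "f \<in> A \<Longrightarrow> f \<in> posi A"
  unfolding posi_def mem_Collect_eq
  by (intro exI[of _ "1::nat"] exI[of _ "\<lambda>_. 1::real"] exI[of _ "\<lambda>_. f"]) simp

lemma posiE:
  assumes "f \<in> posi A"
  obtains m and c :: "nat \<Rightarrow> real" and h
  where "m \<ge> 1" "\<forall>k\<in>{1..m}. h k \<in> A \<and> c k > 0" "f = (\<lambda>z. \<Sum>k=1..m. c k * h k z)"
  using assms unfolding posi_def by auto

lemma posi_scale:
  assumes "f \<in> posi A" and "c > 0"
  shows "(\<lambda>z. c * f z) \<in> posi A"
proof -
  obtain m and b :: "nat \<Rightarrow> real" and h where "m \<ge> 1" "\<forall>k\<in>{1..m}. h k \<in> A \<and> b k > 0"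
    and f: "f = (\<lambda>z. \<Sum>k=1..m. b k * h k z)"
    using assms(1) by (rule posiE)
  then show ?thesis
    unfolding posi_def mem_Collect_eq using assms(2)
    by (intro exI[of _ m] exI[of _ "\<lambda>k. c * b k"] exI[of _ h])
      (simp add: sum_distrib_left mult.assoc)
qed

lemma posi_add:
  assumes "f \<in> posi A" and "g \<in> posi A"
  shows "(\<lambda>z. f z + g z) \<in> posi A"
proof -
  obtain m and b :: "nat \<Rightarrow> real" and h where m: "m \<ge> 1" "\<forall>k\<in>{1..m}. h k \<in> A \<and> b k > 0"
    and f: "f = (\<lambda>z. \<Sum>k=1..m. b k * h k z)"
    using assms(1) by (rule posiE)
  obtain m' and b' :: "nat \<Rightarrow> real" and h' where m': "m' \<ge> 1" "\<forall>k\<in>{1..m'}. h' k \<in> A \<and> b' k > 0"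
    and g: "g = (\<lambda>z. \<Sum>k=1..m'. b' k * h' k z)"
    using assms(2) by (rule posiE)
  \<comment> \<open>The two combinations are concatenated: positions \<open>1..m\<close> carry the
    first and \<open>m + 1..m + m'\<close> the second. Since indices start at 1,
    \<open>k - m\<close> ranges over \<open>{1..m'}\<close> on the second block.\<close>
  define b'' where "b'' k = (if k \<le> m then b k else b' (k - m))" for k
  define h'' where "h'' k = (if k \<le> m then h k else h' (k - m))" for k
  have "(\<Sum>k=1..m + m'. b'' k * h'' k z) = f z + g z" for z
  proof -
    have "(\<Sum>k=1..m + m'. b'' k * h'' k z) =
        (\<Sum>k=1..m. b'' k * h'' k z) + (\<Sum>k=m + 1..m + m'. b'' k * h'' k z)"
      by (rule sum.ub_add_nat) simp
    also have "(\<Sum>k=m + 1..m + m'. b'' k * h'' k z) = (\<Sum>k=1..m'. b'' (k + m) * h'' (k + m) z)"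
      using sum.shift_bounds_cl_nat_ivl[of "\<lambda>k. b'' k * h'' k z" 1 m m']
      by (simp add: add.commute)
    finally show ?thesis by (simp add: b''_def h''_def f g)
  qed
  moreover have "h'' k \<in> A \<and> b'' k > 0" if "k \<in> {1..m + m'}" for k
  proof (cases "k \<le> m")
    case True
    then show ?thesis using m(2) that by (auto simp: b''_def h''_def)
  next
    case False
    then have "k - m \<in> {1..m'}" using that by auto
    then show ?thesis using m'(2) False by (auto simp: b''_def h''_def)
  qed
  ultimately show ?thesis
    unfolding posi_def mem_Collect_eq using m(1)
    by (intro exI[of _ "m + m'"] exI[of _ b''] exI[of _ h'']) auto
qed

lemma posi_sum:
  assumes "finite V" "V \<noteq> {}" "\<And>v. v \<in> V \<Longrightarrow> h v \<in> posi A"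
  shows "(\<lambda>z. \<Sum>v\<in>V. h v z) \<in> posi A"
  using assms by (induction V rule: finite_ne_induct) (auto intro: posi_add)

text \<open>Lets properties compatible with sums and positive multiples be checked on
  \<open>A\<close> alone, without handling explicit combinations.\<close>

lemma posi_induct [consumes 1, case_names base add scale]:
  assumes "f \<in> posi A"
    and base: "\<And>f. f \<in> A \<Longrightarrow> P f"
    and add: "\<And>f g. P f \<Longrightarrow> P g \<Longrightarrow> P (\<lambda>z. f z + g z)"
    and scale: "\<And>c f. c > 0 \<Longrightarrow> P f \<Longrightarrow> P (\<lambda>z. c * f z)"
  shows "P f"
proof -
  obtain m and b :: "nat \<Rightarrow> real" and h where m: "m \<ge> 1" "\<forall>k\<in>{1..m}. h k \<in> A \<and> b k > 0"
    and f: "f = (\<lambda>z. \<Sum>k=1..m. b k * h k z)"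
    using assms(1) by (rule posiE)
  \<comment> \<open>The induction runs over non-empty index sets and starts at singletons, because
    nothing is assumed about \<open>P\<close> at the zero gamble, the value of the empty
    sum.\<close>
  have "finite K \<Longrightarrow> K \<noteq> {} \<Longrightarrow> K \<subseteq> {1..m} \<Longrightarrow> P (\<lambda>z. \<Sum>k\<in>K. b k * h k z)" for K
  proof (induction K rule: finite_ne_induct)
    case (singleton k)
    then show ?case using m base scale by simp
  next
    case (insert k K)
    then show ?case using m base scale add[of "\<lambda>z. b k * h k z"] by simp
  qed
  then show ?thesis using m(1) f by simp
qed

lemma posi_mono: "A \<subseteq> B \<Longrightarrow> f \<in> posi A \<Longrightarrow> f \<in> posi B"
  by (erule posi_induct) (auto intro: posi_base posi_add posi_scale)

text \<open>Needed because suitable weights are found below only for finitely many gambles at a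
  time.\<close>

lemma posi_finite_support:
  assumes "f \<in> posi A"
  shows "\<exists>B. finite B \<and> B \<subseteq> A \<and> f \<in> posi B"
  using assms
proof (induction rule: posi_induct)
  case (base f)
  then show ?case by (intro exI[of _ "{f}"]) (auto intro: posi_base)
next
  case (add f g)
  then obtain B C where "finite B \<and> B \<subseteq> A \<and> f \<in> posi B" "finite C \<and> C \<subseteq> A \<and> g \<in> posi C"
    by blast
  then show ?case
    by (intro exI[of _ "B \<union> C"])
      (auto intro!: posi_add intro: posi_mono[of B "B \<union> C"] posi_mono[of C "B \<union> C"])
next
  case (scale c f)
  then show ?case by (blast intro: posi_scale)
qed

lemma pos_gambles_iff:
  "f \<in> pos_gambles Z \<longleftrightarrow> (\<forall>z. 0 \<le> f z) \<and> (\<forall>z. z \<notin> Z \<longrightarrow> f z = 0) \<and> (\<exists>z\<in>Z. 0 < f z)"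
  unfolding pos_gambles_def gambles_def less_fun_def le_fun_def
  by (auto simp: not_le)

section \<open>A theorem of the alternative for convex cones\<close>

text \<open>Supplies the weight of an eliminated point: \<open>A\<close> will hold its lower bounds
  and \<open>B\<close> its upper bounds, and either may be empty.\<close>

lemma exists_between_finite_sets:
  fixes A B :: "real set"
  assumes "finite A" "finite B" "\<And>a b. a \<in> A \<Longrightarrow> b \<in> B \<Longrightarrow> a < b"
  shows "\<exists>t. (\<forall>a\<in>A. a < t) \<and> (\<forall>b\<in>B. t < b)"
proof (cases "A = {} \<or> B = {}")
  case True
  moreover have "a < Max A + 1" if "a \<in> A" for a
    using Max_ge[OF assms(1) that] by simp
  moreover have "Min B - 1 < b" if "b \<in> B" for b
    using Min_le[OF assms(2) that] by simp
  ultimately show ?thesis by blast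
next
  case False
  then have "Max A < Min B" using assms by simp
  then obtain t where "Max A < t" "t < Min B" using dense by blast
  then show ?thesis using False assms by (intro exI[of _ t]) auto
qed

(* Fourier-Motzkin elimination of one point of Z at a time. *)
lemma cone_positive_functional:
  fixes C G :: "('z \<Rightarrow> real) set"
  assumes "finite Z" "finite G" "G \<subseteq> C"
    and "\<And>f g. f \<in> C \<Longrightarrow> g \<in> C \<Longrightarrow> (\<lambda>z. f z + g z) \<in> C"
    and "\<And>c f. c > 0 \<Longrightarrow> f \<in> C \<Longrightarrow> (\<lambda>z. c * f z) \<in> C"
    and "\<And>f. f \<in> C \<Longrightarrow> \<exists>z\<in>Z. f z \<noteq> 0"
  shows "\<exists>p. \<forall>g\<in>G. (\<Sum>z\<in>Z. p z * g z) > 0"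
  using assms
proof (induction Z arbitrary: G C rule: finite_induct)
  case empty
  \<comment> \<open>Over the empty set no gamble is non-zero somewhere, so \<open>C\<close>, and
    with it \<open>G\<close>, is empty.\<close>
  then show ?case by blast
next
  case (insert z Z)
  define P where "P = {g \<in> G. g z > 0}"
  define M where "M = {g \<in> G. g z < 0}"
  \<comment> \<open>The combination of \<open>g\<close> and \<open>h\<close> whose value at
    \<open>z\<close> cancels. Both coefficients are positive for \<open>g\<close> in
    \<open>P\<close> and \<open>h\<close> in \<open>M\<close>, so it stays in the cone.\<close>
  define comb :: "('z \<Rightarrow> real) \<times> ('z \<Rightarrow> real) \<Rightarrow> 'z \<Rightarrow> real"
    where "comb = (\<lambda>(g, h) x. g z * h x + (- h z) * g x)"
  define G' where "G' = {g \<in> G. g z = 0} \<union> comb ` (P \<times> M)"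
  have fin: "finite P" "finite M" using insert.prems(1) by (auto simp: P_def M_def)
  have "\<exists>p. \<forall>g\<in>G'. (\<Sum>x\<in>Z. p x * g x) > 0"
  \<comment> \<open>The smaller cone consists of the members of \<open>C\<close> that vanish at
    \<open>z\<close>; such a member is non-zero somewhere on \<open>insert z Z\<close>, hence on
    \<open>Z\<close>.\<close>
  proof (rule insert.IH[of _ "{f \<in> C. f z = 0}"])
    show "finite G'" using insert.prems(1) fin by (simp add: G'_def)
    have "comb (g, h) \<in> C" if "g \<in> P" "h \<in> M" for g h
      unfolding comb_def prod.case using that insert.prems(2)
      by (intro insert.prems(3) insert.prems(4)) (auto simp: P_def M_def)
    then show "G' \<subseteq> {f \<in> C. f z = 0}"
      using insert.prems(2) by (auto simp: G'_def) (simp add: comb_def)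
    show "\<exists>x\<in>Z. f x \<noteq> 0" if "f \<in> {f \<in> C. f z = 0}" for f
      using that insert.prems(5)[of f] by auto
  qed (auto intro: insert.prems)
  then obtain p where p: "\<And>g. g \<in> G' \<Longrightarrow> (\<Sum>x\<in>Z. p x * g x) > 0" by blast
  define s where "s g = (\<Sum>x\<in>Z. p x * g x)" for g
  \<comment> \<open>The weight \<open>t\<close> of \<open>z\<close> has to satisfy
    \<open>t * g z + s g > 0\<close> on \<open>G\<close>. This is a lower bound for \<open>g\<close>
    in \<open>P\<close> and an upper bound for \<open>g\<close> in \<open>M\<close>; the bounds are
    compatible because \<open>p\<close> is positive on each \<open>comb (g, h)\<close>.\<close>
  have "\<exists>t. (\<forall>a\<in>(\<lambda>g. - s g / g z) ` P. a < t) \<and> (\<forall>b\<in>(\<lambda>h. - s h / h z) ` M. t < b)"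
  proof (rule exists_between_finite_sets)
    fix a b assume "a \<in> (\<lambda>g. - s g / g z) ` P" "b \<in> (\<lambda>h. - s h / h z) ` M"
    then obtain g h where gh: "g \<in> P" "h \<in> M" and a: "a = - s g / g z" and b: "b = - s h / h z"
      by blast
    then have "comb (g, h) \<in> G'" by (auto simp: G'_def)
    then have "0 < (\<Sum>x\<in>Z. p x * comb (g, h) x)" by (rule p)
    also have "\<dots> = g z * s h - h z * s g"
      by (simp add: comb_def s_def sum_distrib_left algebra_simps flip: sum_subtractf)
    finally show "a < b" using gh unfolding a b P_def M_def by (simp add: field_simps)
  qed (use fin in auto)
  then obtain t where t: "\<forall>g\<in>P. - s g / g z < t" "\<forall>h\<in>M. t < - s h / h z"
    by (simp only: ball_simps) blast
  have "(\<Sum>x\<in>insert z Z. (p(z := t)) x * g x) > 0" if "g \<in> G" for g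
  proof -
    have "(\<Sum>x\<in>Z. (p(z := t)) x * g x) = s g"
      unfolding s_def using insert.hyps by (intro sum.cong) auto
    moreover have "t * g z + s g > 0"
    proof (cases "g z" "0::real" rule: linorder_cases)
      case less
      then show ?thesis using bspec[OF t(2), of g] that by (simp add: M_def field_simps)
    next
      case equal
      then show ?thesis using p[of g] that by (simp add: G'_def s_def)
    next
      case greater
      then show ?thesis using bspec[OF t(1), of g] that by (simp add: P_def field_simps)
    qed
    ultimately show ?thesis using insert.hyps by simp
  qed
  then show ?case by blast
qed

text \<open>A coherent set is a convex cone without the zero gamble, so the preceding elimination
  applies to it. Adding the indicators of the points of \<open>Z\<close> to \<open>G\<close> makes
  the weights themselves positive.\<close>

lemma coherent_positive_weights:
  assumes "coherent Z D" "finite Z" "finite G" "G \<subseteq> D"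
  shows "\<exists>p. (\<forall>z\<in>Z. p z > 0) \<and> (\<forall>g\<in>G. (\<Sum>z\<in>Z. p z * g z) > 0)"
proof -
  have D: "D \<subseteq> gambles Z" "(\<lambda>_. 0) \<notin> D" "pos_gambles Z \<subseteq> D" "posi D = D"
    using assms(1) by (auto simp: coherent_def)
  have ind: "(indicator {z} :: _ \<Rightarrow> real) \<in> D" if "z \<in> Z" for z
    using that by (intro subsetD[OF D(3)]) (auto simp: pos_gambles_iff indicator_def)
  have "\<exists>p. \<forall>g\<in>G \<union> (\<lambda>z. indicator {z}) ` Z. (\<Sum>z\<in>Z. p z * g z) > 0"
  proof (rule cone_positive_functional[where C = D])
    show "\<exists>z\<in>Z. f z \<noteq> 0" if f: "f \<in> D" for f
    proof (rule ccontr)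
      assume "\<not> (\<exists>z\<in>Z. f z \<noteq> 0)"
      then have "f = (\<lambda>_. 0)" using D(1) f by (auto simp: gambles_def)
      then show False using D(2) f by simp
    qed
  qed (use assms ind posi_add[of _ D] posi_scale[of _ D] D(4) in auto)
  then obtain p where p: "\<forall>g\<in>G \<union> (\<lambda>z. indicator {z}) ` Z. (\<Sum>z\<in>Z. p z * g z) > 0" ..
  moreover have "(\<Sum>x\<in>Z. p x * indicator {z} x) = p z" if "z \<in> Z" for z
    using that assms(2) by (simp add: indicator_def sum.delta' if_distrib cong: if_cong)
  ultimately show ?thesis by (intro exI[of _ p]) (simp add: ball_Un)
qed

section \<open>Generators of the independent product\<close>

definition elem_gamble :: "('n \<Rightarrow> 'a set) \<Rightarrow> 'n set \<Rightarrow> 'n \<Rightarrow> ('a \<Rightarrow> real) \<Rightarrow> ('n \<Rightarrow> 'a)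
    \<Rightarrow> ('n \<Rightarrow> 'a) \<Rightarrow> real" where
  "elem_gamble X R r g y =
     (\<lambda>x. if x \<in> Pi\<^sub>E R X \<and> restrict x (R - {r}) = y then g (x r) else 0)"

lemma elem_gamble_eq:
  "(\<lambda>x. cyl X (R - {r}) R (indicator {y}) x * cyl1 X r R g x) = elem_gamble X R r g y"
  by (auto simp: cyl_def cyl1_def elem_gamble_def indicator_def fun_eq_iff)

definition generators :: "('n \<Rightarrow> 'a set) \<Rightarrow> 'n set
    \<Rightarrow> ('n \<Rightarrow> ('a \<Rightarrow> real) set) \<Rightarrow> (('n \<Rightarrow> 'a) \<Rightarrow> real) set" where
  "generators X R D = pos_gambles (Pi\<^sub>E R X) \<union>
     (\<Union>r\<in>R. (\<lambda>(g, y). elem_gamble X R r g y) ` (D r \<times> Pi\<^sub>E (R - {r}) X))"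

lemma elem_gamble_in_generators:
  "r \<in> R \<Longrightarrow> g \<in> D r \<Longrightarrow> y \<in> Pi\<^sub>E (R - {r}) X \<Longrightarrow> elem_gamble X R r g y \<in> generators X R D"
  unfolding generators_def by (intro UnI2 UN_I[of r] image_eqI[of _ _ "(g, y)"]) auto

text \<open>The inner positive hulls in \<open>ind_prod\<close> are absorbed by the outer one.
  Inductions over the product then only have to treat positive gambles and single elementary
  gambles.\<close>

lemma ind_prod_eq_posi_generators: "ind_prod X R D = posi (generators X R D)"
proof -
  define E where "E r = (\<lambda>(g, y). elem_gamble X R r g y) ` (D r \<times> Pi\<^sub>E (R - {r}) X)" for r
  have E: "{elem_gamble X R r g y | g y. g \<in> D r \<and> y \<in> Pi\<^sub>E (R - {r}) X} = E r" for r
    unfolding E_def by auto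
  have "f \<in> posi (generators X R D)" if "f \<in> ind_prod X R D" for f
    using that unfolding ind_prod_def elem_gamble_eq E
  proof (induction rule: posi_induct)
    case (base f)
    moreover have "g \<in> posi (generators X R D)" if "g \<in> posi (E r)" "r \<in> R" for g r
      using that by (intro posi_mono[of "E r" "generators X R D"]) (auto simp: generators_def E_def)
    ultimately show ?case by (auto simp: generators_def intro: posi_base)
  qed (auto intro: posi_add posi_scale)
  moreover have "f \<in> ind_prod X R D" if "f \<in> posi (generators X R D)" for f
    unfolding ind_prod_def elem_gamble_eq E
    by (rule posi_mono[OF _ that]) (auto simp: generators_def E_def[symmetric] intro: posi_base)
  ultimately show ?thesis by blast
qed

lemma ind_prod_subset_gambles: "ind_prod X R D \<subseteq> gambles (Pi\<^sub>E R X)"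
proof
  fix f assume "f \<in> ind_prod X R D"
  then show "f \<in> gambles (Pi\<^sub>E R X)"
    unfolding ind_prod_eq_posi_generators
  proof (induction rule: posi_induct)
    case (base f)
    moreover have "pos_gambles (Pi\<^sub>E R X) \<subseteq> gambles (Pi\<^sub>E R X)"
      unfolding pos_gambles_def by (rule Collect_restrict)
    moreover have "elem_gamble X R r g y \<in> gambles (Pi\<^sub>E R X)" for r g y
      by (simp add: gambles_def elem_gamble_def)
    ultimately show ?case by (auto simp: generators_def)
  qed (auto simp: gambles_def)
qed

section \<open>Gluing of points, and conditioned cylindrical extensions\<close>

definition glue :: "'n set \<Rightarrow> ('n \<Rightarrow> 'a) \<Rightarrow> ('n \<Rightarrow> 'a) \<Rightarrow> 'n \<Rightarrow> 'a" where
  "glue J y z = (\<lambda>n. if n \<in> J then y n else z n)"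

lemma glue_in_PiE:
  "J \<subseteq> N \<Longrightarrow> y \<in> Pi\<^sub>E J X \<Longrightarrow> z \<in> Pi\<^sub>E (N - J) X \<Longrightarrow> glue J y z \<in> Pi\<^sub>E N X"
  by (auto simp: glue_def PiE_iff extensional_def)

text \<open>The indicator of \<open>xI\<close> times the cylindrical extension of \<open>f\<close>.
  For \<open>I = {}\<close> and \<open>xI = (\<lambda>_. undefined)\<close> it is the plain
  extension, so conditional and unconditional marginals can be treated by one argument.\<close>

definition cond_cyl :: "('n \<Rightarrow> 'a set) \<Rightarrow> 'n set \<Rightarrow> 'n set \<Rightarrow> 'n set \<Rightarrow> ('n \<Rightarrow> 'a)
    \<Rightarrow> (('n \<Rightarrow> 'a) \<Rightarrow> real) \<Rightarrow> ('n \<Rightarrow> 'a) \<Rightarrow> real" where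
  "cond_cyl X N I J xI f =
     (\<lambda>x. if x \<in> Pi\<^sub>E N X \<and> restrict x I = xI then f (restrict x J) else 0)"

text \<open>As \<open>J\<close> lies in \<open>N - I\<close>, extending from \<open>J\<close> to
  \<open>N - I\<close> and then to \<open>N\<close> is the same as extending at once.\<close>

lemma marg_cond_iff:
  assumes "I \<subseteq> N" "J \<subseteq> N" "I \<inter> J = {}"
  shows "f \<in> marg X (N - I) J (cond X N I P xI) \<longleftrightarrow>
    f \<in> gambles (Pi\<^sub>E J X) \<and> cond_cyl X N I J xI f \<in> P"
proof -
  have J: "J \<subseteq> N - I" using assms by blast
  have "restrict x (N - I) \<in> Pi\<^sub>E (N - I) X" if "x \<in> Pi\<^sub>E N X" for x
    using that by (auto simp: PiE_iff)
  then have "(\<lambda>x. cyl X I N (indicator {xI}) x * cyl X (N - I) N (cyl X J (N - I) f) x)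
      = cond_cyl X N I J xI f"
    using J by (auto simp: fun_eq_iff cyl_def cond_cyl_def indicator_def Int_absorb1)
  then show ?thesis by (auto simp: marg_def cond_def gambles_def cyl_def)
qed

lemma marg_iff:
  "f \<in> marg X N J P \<longleftrightarrow> f \<in> gambles (Pi\<^sub>E J X) \<and> cond_cyl X N {} J (\<lambda>_. undefined) f \<in> P"
proof -
  have "cyl X J N f = cond_cyl X N {} J (\<lambda>_. undefined) f"
    by (auto simp: fun_eq_iff cyl_def cond_cyl_def)
  then show ?thesis by (simp add: marg_def)
qed

text \<open>Non-empty factors supply the coordinates outside \<open>I\<close> and \<open>J\<close>,
  and disjointness lets both prescribed parts be glued in. This keeps positive gambles non-zero and
  the sums used later non-empty.\<close>

lemma ex_PiE_extending:
  assumes "\<And>n. n \<in> N \<Longrightarrow> X n \<noteq> {}" "I \<subseteq> N" "J \<subseteq> N" "I \<inter> J = {}"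
    and "xI \<in> Pi\<^sub>E I X" "y \<in> Pi\<^sub>E J X"
  shows "\<exists>x\<in>Pi\<^sub>E N X. restrict x I = xI \<and> restrict x J = y"
proof -
  obtain z where "z \<in> Pi\<^sub>E (N - J - I) X"
    using assms(1) PiE_eq_empty_iff[of "N - J - I" X] by blast
  moreover have "I \<subseteq> N - J" using assms by blast
  ultimately have "glue I xI z \<in> Pi\<^sub>E (N - J) X"
    using assms(5) by (intro glue_in_PiE)
  then have "glue J y (glue I xI z) \<in> Pi\<^sub>E N X"
    by (rule glue_in_PiE[OF assms(3,6)])
  moreover have "restrict (glue J y (glue I xI z)) I = xI" "restrict (glue J y (glue I xI z)) J = y"
    using assms by (auto simp: glue_def fun_eq_iff PiE_iff extensional_def)
  ultimately show ?thesis by blast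
qed

section \<open>From the product over \<open>J\<close> to the product over \<open>N\<close>\<close>

text \<open>\<open>cond_cyl\<close> is linear in \<open>f\<close>, so generators suffice. A positive
  gamble stays positive, since a point where it is positive extends to one over \<open>N\<close>
  that agrees with \<open>xI\<close>; an elementary gamble becomes a sum of elementary
  gambles.\<close>

lemma cond_cyl_in_ind_prod:
  assumes "finite N" "\<And>n. n \<in> N \<Longrightarrow> finite (X n) \<and> X n \<noteq> {}"
    and IJ: "I \<subseteq> N" "J \<subseteq> N" "I \<inter> J = {}" and xI: "xI \<in> Pi\<^sub>E I X"
    and f: "f \<in> ind_prod X J D"
  shows "cond_cyl X N I J xI f \<in> ind_prod X N D"
  using f unfolding ind_prod_eq_posi_generators
proof (induction rule: posi_induct)
  case (base f)
  from base consider "f \<in> pos_gambles (Pi\<^sub>E J X)"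
    | r g y where "r \<in> J" "g \<in> D r" "y \<in> Pi\<^sub>E (J - {r}) X" "f = elem_gamble X J r g y"
    by (auto simp: generators_def)
  then show ?case
  proof cases
    case 1
    then obtain y where y: "y \<in> Pi\<^sub>E J X" "0 < f y" by (auto simp: pos_gambles_iff)
    then obtain x where "x \<in> Pi\<^sub>E N X" "restrict x I = xI" "restrict x J = y"
      using ex_PiE_extending[of N X I J xI y] assms by blast
    then have "cond_cyl X N I J xI f \<in> pos_gambles (Pi\<^sub>E N X)"
      using 1 y by (auto simp: pos_gambles_iff cond_cyl_def intro!: bexI[of _ x])
    then show ?thesis by (intro posi_base) (simp add: generators_def)
  next
    case 2
    \<comment> \<open>All ways to fill the coordinates other than \<open>r\<close> compatibly with
      \<open>xI\<close> and \<open>y\<close>. Because \<open>r\<close> is in \<open>J\<close> and so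
      not in \<open>I\<close>, each \<open>x\<close> compatible with both has exactly one such
      \<open>v\<close>, and the elementary gambles at \<open>V\<close> add up to
      \<open>cond_cyl X N I J xI f\<close>.\<close>
    define V where "V = {v \<in> Pi\<^sub>E (N - {r}) X. restrict v I = xI \<and> restrict v (J - {r}) = y}"
    have "finite V" unfolding V_def using assms(1,2) finite_PiE[of "N - {r}" X] by auto
    moreover have "V \<noteq> {}"
      using ex_PiE_extending[of "N - {r}" X I "J - {r}" xI y] assms 2 unfolding V_def by blast
    moreover have "elem_gamble X N r g v \<in> posi (generators X N D)" if "v \<in> V" for v
      using 2 IJ that by (auto intro!: posi_base elem_gamble_in_generators simp: V_def)
    ultimately have "(\<lambda>x. \<Sum>v\<in>V. elem_gamble X N r g v x) \<in> posi (generators X N D)"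
      by (rule posi_sum)
    moreover have "(\<Sum>v\<in>V. elem_gamble X N r g v x) = cond_cyl X N I J xI f x" for x
    proof -
      have "(\<Sum>v\<in>V. elem_gamble X N r g v x) =
          (\<Sum>v\<in>V. if restrict x (N - {r}) = v then (if x \<in> Pi\<^sub>E N X then g (x r) else 0) else 0)"
        by (intro sum.cong) (auto simp: elem_gamble_def)
      also have "\<dots> = (if x \<in> Pi\<^sub>E N X \<and> restrict x (N - {r}) \<in> V then g (x r) else 0)"
        using \<open>finite V\<close> by (auto simp: sum.delta)
      also have "\<dots> = cond_cyl X N I J xI f x"
      proof -
        have "(N - {r}) \<inter> I = I" "(N - {r}) \<inter> (J - {r}) = J - {r}" "J \<inter> (J - {r}) = J - {r}"
          using 2 IJ by auto
        moreover have "restrict x J \<in> Pi\<^sub>E J X" "restrict x (N - {r}) \<in> Pi\<^sub>E (N - {r}) X"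
          if "x \<in> Pi\<^sub>E N X"
          using that IJ by (auto simp: PiE_iff)
        ultimately show ?thesis
          using 2 by (auto simp: cond_cyl_def elem_gamble_def V_def)
      qed
      finally show ?thesis .
    qed
    ultimately show ?thesis by simp
  qed
next
  case (add f g)
  have "cond_cyl X N I J xI (\<lambda>z. f z + g z) =
      (\<lambda>z. cond_cyl X N I J xI f z + cond_cyl X N I J xI g z)"
    by (auto simp: cond_cyl_def)
  then show ?case using add by (simp add: posi_add)
next
  case (scale c f)
  have "cond_cyl X N I J xI (\<lambda>z. c * f z) = (\<lambda>z. c * cond_cyl X N I J xI f z)"
    by (auto simp: cond_cyl_def)
  then show ?case using scale by (simp add: posi_scale)
qed

section \<open>Averaging out the coordinates outside \<open>J\<close>\<close>

text \<open>Integration over the coordinates outside \<open>J\<close> against the product of the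
  weights \<open>p n\<close>. The weights are not normalised, which is harmless since positive hulls
  are closed under positive multiples.\<close>

definition average :: "('n \<Rightarrow> 'a set) \<Rightarrow> 'n set \<Rightarrow> 'n set \<Rightarrow> ('n \<Rightarrow> 'a \<Rightarrow> real)
    \<Rightarrow> (('n \<Rightarrow> 'a) \<Rightarrow> real) \<Rightarrow> ('n \<Rightarrow> 'a) \<Rightarrow> real" where
  "average X N J p F = (\<lambda>y. if y \<in> Pi\<^sub>E J X
     then \<Sum>z\<in>Pi\<^sub>E (N - J) X. (\<Prod>n\<in>N - J. p n (z n)) * F (glue J y z) else 0)"

lemma average_pos_gamble:
  assumes "finite N" "\<And>n. n \<in> N \<Longrightarrow> finite (X n)" "J \<subseteq> N"
    and p: "\<And>n a. n \<in> N \<Longrightarrow> a \<in> X n \<Longrightarrow> p n a > 0"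
    and F: "F \<in> pos_gambles (Pi\<^sub>E N X)"
  shows "average X N J p F \<in> pos_gambles (Pi\<^sub>E J X)"
proof -
  obtain x where x: "x \<in> Pi\<^sub>E N X" "0 < F x" using F by (auto simp: pos_gambles_iff)
  have w: "(\<Prod>n\<in>N - J. p n (z n)) > 0" if "z \<in> Pi\<^sub>E (N - J) X" for z
    using that by (intro prod_pos) (auto intro: p)
  have F0: "0 \<le> F u" for u using F by (simp add: pos_gambles_iff)
  have "restrict x J \<in> Pi\<^sub>E J X" using x \<open>J \<subseteq> N\<close> by (auto simp: PiE_iff)
  \<comment> \<open>The term at \<open>z = restrict x (N - J)\<close> is positive, because gluing
    the two restrictions of \<open>x\<close> gives back \<open>x\<close>.\<close>
  moreover have "0 < (\<Sum>z\<in>Pi\<^sub>E (N - J) X. (\<Prod>n\<in>N - J. p n (z n)) * F (glue J (restrict x J) z))"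
  proof (rule sum_pos2[of _ "restrict x (N - J)"])
    show "restrict x (N - J) \<in> Pi\<^sub>E (N - J) X" using x by (auto simp: PiE_iff)
    have "glue J (restrict x J) (restrict x (N - J)) = x"
      using x \<open>J \<subseteq> N\<close> by (auto simp: glue_def fun_eq_iff PiE_iff extensional_def)
    then show "0 < (\<Prod>n\<in>N - J. p n (restrict x (N - J) n)) *
        F (glue J (restrict x J) (restrict x (N - J)))"
      using x w[of "restrict x (N - J)"] \<open>restrict x (N - J) \<in> _\<close> by simp
    show "finite (Pi\<^sub>E (N - J) X)" using assms by (intro finite_PiE) auto
  qed (use F0 w in \<open>simp add: less_imp_le\<close>)
  ultimately show ?thesis
    using F0 w
    by (auto simp: pos_gambles_iff average_def less_imp_le intro!: sum_nonneg bexI[of _ "restrict x J"])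
qed

text \<open>With \<open>r\<close> in \<open>J\<close>, the point \<open>v\<close> fixes every
  averaged coordinate, so only the term \<open>z = restrict v (N - J)\<close> survives.\<close>

lemma average_elem_gamble_inside:
  assumes "finite N" "\<And>n. n \<in> N \<Longrightarrow> finite (X n)" "J \<subseteq> N" "r \<in> J" "v \<in> Pi\<^sub>E (N - {r}) X"
  shows "average X N J p (elem_gamble X N r g v) =
    (\<lambda>y. (\<Prod>n\<in>N - J. p n (v n)) * elem_gamble X J r g (restrict v (J - {r})) y)"
proof
  fix y
  show "average X N J p (elem_gamble X N r g v) y =
    (\<Prod>n\<in>N - J. p n (v n)) * elem_gamble X J r g (restrict v (J - {r})) y"
  proof (cases "y \<in> Pi\<^sub>E J X")
    case True
    have fin: "finite (Pi\<^sub>E (N - J) X)" using assms by (intro finite_PiE) auto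
    have vJ: "restrict v (N - J) \<in> Pi\<^sub>E (N - J) X" using assms by (auto simp: PiE_iff)
    have eq: "restrict (glue J y z) (N - {r}) = v \<longleftrightarrow>
        restrict y (J - {r}) = restrict v (J - {r}) \<and> z = restrict v (N - J)"
      if "z \<in> Pi\<^sub>E (N - J) X" for z
    proof
      assume v: "restrict (glue J y z) (N - {r}) = v"
      show "restrict y (J - {r}) = restrict v (J - {r}) \<and> z = restrict v (N - J)"
        unfolding v[symmetric] using that assms(3,4)
        by (auto simp: fun_eq_iff glue_def PiE_iff extensional_def)
    next
      assume *: "restrict y (J - {r}) = restrict v (J - {r}) \<and> z = restrict v (N - J)"
      have "y n = v n" if "n \<in> J" "n \<noteq> r" for n
        using fun_cong[OF conjunct1[OF *], of n] that by simp
      then show "restrict (glue J y z) (N - {r}) = v"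
        using * assms(3-5) by (auto simp: fun_eq_iff glue_def PiE_iff extensional_def)
    qed
    have "average X N J p (elem_gamble X N r g v) y =
        (\<Sum>z\<in>Pi\<^sub>E (N - J) X. if z = restrict v (N - J)
          then (\<Prod>n\<in>N - J. p n (v n)) * elem_gamble X J r g (restrict v (J - {r})) y else 0)"
      unfolding average_def if_P[OF True]
    proof (rule sum.cong)
      fix z assume z: "z \<in> Pi\<^sub>E (N - J) X"
      then have "glue J y z \<in> Pi\<^sub>E N X" using True assms by (intro glue_in_PiE)
      moreover have "glue J y z r = y r" using assms(4) by (simp add: glue_def)
      ultimately have "elem_gamble X N r g v (glue J y z) =
          (if restrict y (J - {r}) = restrict v (J - {r}) \<and> z = restrict v (N - J)
           then g (y r) else 0)"
        by (simp only: elem_gamble_def eq[OF z] simp_thms)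
      then show "(\<Prod>n\<in>N - J. p n (z n)) * elem_gamble X N r g v (glue J y z) =
          (if z = restrict v (N - J)
          then (\<Prod>n\<in>N - J. p n (v n)) * elem_gamble X J r g (restrict v (J - {r})) y else 0)"
        using True by (simp add: elem_gamble_def)
    qed simp
    also have "\<dots> = (\<Prod>n\<in>N - J. p n (v n)) * elem_gamble X J r g (restrict v (J - {r})) y"
      using fin vJ by simp
    finally show ?thesis .
  qed (simp add: average_def elem_gamble_def)
qed

text \<open>The points that agree with \<open>v\<close> away from \<open>r\<close> are the updates
  \<open>v(r := a)\<close>. This evaluates the averaging sum when \<open>r\<close> itself is
  averaged out.\<close>

lemma sum_PiE_one_free:
  assumes "finite K" "\<And>n. n \<in> K \<Longrightarrow> finite (X n)" "r \<in> K" "v \<in> Pi\<^sub>E (K - {r}) X"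
  shows "(\<Sum>z\<in>Pi\<^sub>E K X. if restrict z (K - {r}) = v then h z else 0) =
    (\<Sum>a\<in>X r. h (v(r := a)))"
proof -
  have "finite (Pi\<^sub>E K X)" using assms by (intro finite_PiE)
  then have "(\<Sum>z\<in>Pi\<^sub>E K X. if restrict z (K - {r}) = v then h z else 0) =
      (\<Sum>z\<in>{z \<in> Pi\<^sub>E K X. restrict z (K - {r}) = v}. h z)"
    by (rule sum.inter_filter[symmetric])
  also have "\<dots> = (\<Sum>a\<in>X r. h (v(r := a)))"
  proof (rule sum.reindex_bij_witness[of _ "\<lambda>a. v(r := a)" "\<lambda>z. z r"])
    fix z assume "z \<in> {z \<in> Pi\<^sub>E K X. restrict z (K - {r}) = v}"
    then have z: "z \<in> Pi\<^sub>E K X" and v: "restrict z (K - {r}) = v" by auto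
    show "v(r := z r) = z" unfolding v[symmetric]
      using z assms(3) by (auto simp: fun_eq_iff PiE_iff extensional_def)
    show "z r \<in> X r" using z assms(3) by auto
    show "h (v(r := z r)) = h z" by (simp add: \<open>v(r := z r) = z\<close>)
  next
    fix a assume "a \<in> X r"
    then show "v(r := a) \<in> {z \<in> Pi\<^sub>E K X. restrict z (K - {r}) = v}"
      using assms(3,4) by (auto simp: fun_eq_iff PiE_iff extensional_def)
  qed simp
  finally show ?thesis .
qed

text \<open>With \<open>r\<close> outside \<open>J\<close>, the point \<open>v\<close> fixes
  \<open>y\<close> and all averaged coordinates except \<open>r\<close>. What remains is the
  expectation of \<open>g\<close> under \<open>p r\<close>, whose sign is controlled by the choice
  of weights.\<close>

lemma average_elem_gamble_outside:
  assumes "finite N" "\<And>n. n \<in> N \<Longrightarrow> finite (X n)" "J \<subseteq> N" "r \<in> N - J" "v \<in> Pi\<^sub>E (N - {r}) X"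
    and "y \<in> Pi\<^sub>E J X"
  shows "average X N J p (elem_gamble X N r g v) y =
    (if y = restrict v J
     then (\<Prod>n\<in>N - J - {r}. p n (v n)) * (\<Sum>a\<in>X r. p r a * g a) else 0)"
proof -
  define u where "u = restrict v (N - J - {r})"
  have u: "u \<in> Pi\<^sub>E (N - J - {r}) X" using assms(5) by (auto simp: u_def PiE_iff)
  have eq: "restrict (glue J y z) (N - {r}) = v \<longleftrightarrow> y = restrict v J \<and> restrict z (N - J - {r}) = u"
    if "z \<in> Pi\<^sub>E (N - J) X" for z
  proof
    assume v: "restrict (glue J y z) (N - {r}) = v"
    show "y = restrict v J \<and> restrict z (N - J - {r}) = u"
      unfolding u_def v[symmetric] using that assms(3,4,6)
      by (auto simp: fun_eq_iff glue_def PiE_iff extensional_def)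
  next
    assume *: "y = restrict v J \<and> restrict z (N - J - {r}) = u"
    have "z n = v n" if "n \<in> N" "n \<notin> J" "n \<noteq> r" for n
      using fun_cong[OF conjunct2[OF *], of n] that by (simp add: u_def)
    then show "restrict (glue J y z) (N - {r}) = v"
      using * assms(3-5) by (auto simp: fun_eq_iff glue_def PiE_iff extensional_def)
  qed
  have "average X N J p (elem_gamble X N r g v) y =
      (\<Sum>z\<in>Pi\<^sub>E (N - J) X. if restrict z (N - J - {r}) = u
        then (if y = restrict v J then (\<Prod>n\<in>N - J. p n (z n)) * g (z r) else 0) else 0)"
    unfolding average_def if_P[OF assms(6)]
  proof (rule sum.cong)
    fix z assume z: "z \<in> Pi\<^sub>E (N - J) X"
    then have "glue J y z \<in> Pi\<^sub>E N X" using assms by (intro glue_in_PiE)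
    moreover have "glue J y z r = z r" using assms(4) by (simp add: glue_def)
    ultimately have "elem_gamble X N r g v (glue J y z) =
        (if y = restrict v J \<and> restrict z (N - J - {r}) = u then g (z r) else 0)"
      by (simp only: elem_gamble_def eq[OF z] simp_thms)
    then show "(\<Prod>n\<in>N - J. p n (z n)) * elem_gamble X N r g v (glue J y z) =
        (if restrict z (N - J - {r}) = u
         then (if y = restrict v J then (\<Prod>n\<in>N - J. p n (z n)) * g (z r) else 0) else 0)"
      by simp
  qed simp
  also have "\<dots> = (\<Sum>a\<in>X r. if y = restrict v J
      then (\<Prod>n\<in>N - J. p n ((u(r := a)) n)) * g ((u(r := a)) r) else 0)"
    using assms u by (intro sum_PiE_one_free) auto
  also have "\<dots> = (\<Sum>a\<in>X r. if y = restrict v J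
      then (\<Prod>n\<in>N - J - {r}. p n (v n)) * (p r a * g a) else 0)"
  proof -
    have "(\<Prod>n\<in>N - J. p n ((u(r := a)) n)) = p r a * (\<Prod>n\<in>N - J - {r}. p n (v n))" for a
    proof -
      have "(\<Prod>n\<in>N - J. p n ((u(r := a)) n)) =
          p r ((u(r := a)) r) * (\<Prod>n\<in>N - J - {r}. p n ((u(r := a)) n))"
        using assms by (intro prod.remove) auto
      also have "(\<Prod>n\<in>N - J - {r}. p n ((u(r := a)) n)) = (\<Prod>n\<in>N - J - {r}. p n (v n))"
        by (intro prod.cong) (auto simp: u_def)
      finally show ?thesis by simp
    qed
    then show ?thesis by (intro sum.cong) (auto simp: mult_ac)
  qed
  also have "\<dots> = (if y = restrict v J
      then (\<Prod>n\<in>N - J - {r}. p n (v n)) * (\<Sum>a\<in>X r. p r a * g a) else 0)"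
    by (simp add: sum_distrib_left)
  finally show ?thesis .
qed

text \<open>As \<open>I\<close> is disjoint from \<open>J\<close>, the indicator depends only on
  averaged coordinates and \<open>f\<close> only on retained ones, so the average
  factorises.\<close>

lemma average_cond_cyl:
  assumes "I \<subseteq> N" "J \<subseteq> N" "I \<inter> J = {}" "f \<in> gambles (Pi\<^sub>E J X)"
  shows "average X N J p (cond_cyl X N I J xI f) =
    (\<lambda>y. (\<Sum>z\<in>Pi\<^sub>E (N - J) X. if restrict z I = xI then \<Prod>n\<in>N - J. p n (z n) else 0) * f y)"
proof
  fix y
  show "average X N J p (cond_cyl X N I J xI f) y =
    (\<Sum>z\<in>Pi\<^sub>E (N - J) X. if restrict z I = xI then \<Prod>n\<in>N - J. p n (z n) else 0) * f y"
  proof (cases "y \<in> Pi\<^sub>E J X")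
    case True
    have "cond_cyl X N I J xI f (glue J y z) = (if restrict z I = xI then f y else 0)"
      if "z \<in> Pi\<^sub>E (N - J) X" for z
    proof -
      have "glue J y z \<in> Pi\<^sub>E N X" using True that assms by (intro glue_in_PiE)
      moreover have "restrict (glue J y z) I = restrict z I" "restrict (glue J y z) J = y"
        using True assms(3) by (auto simp: glue_def fun_eq_iff PiE_iff extensional_def)
      ultimately show ?thesis by (simp add: cond_cyl_def)
    qed
    then show ?thesis
      unfolding average_def if_P[OF True] sum_distrib_right by (intro sum.cong) auto
  next
    case False
    then show ?thesis using assms(4) by (simp add: average_def gambles_def)
  qed
qed

lemma average_add:
  "average X N J p (\<lambda>x. F x + G x) = (\<lambda>y. average X N J p F y + average X N J p G y)"
  by (auto simp: average_def sum.distrib distrib_left)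

lemma average_scale: "average X N J p (\<lambda>x. c * F x) = (\<lambda>y. c * average X N J p F y)"
  by (auto simp: average_def sum_distrib_left mult_ac)

text \<open>If \<open>r\<close> is in \<open>J\<close>, the average is a positive multiple of a
  generator over \<open>J\<close>. Otherwise it is a positive gamble concentrated at
  \<open>restrict v J\<close>, by positivity of the expectation of \<open>g\<close>.\<close>

lemma average_elem_gamble_in_ind_prod:
  assumes "finite N" "\<And>n. n \<in> N \<Longrightarrow> finite (X n)" "J \<subseteq> N"
    and p: "\<And>n a. n \<in> N \<Longrightarrow> a \<in> X n \<Longrightarrow> p n a > 0"
    and r: "r \<in> N" and g: "g \<in> D r" "(\<Sum>a\<in>X r. p r a * g a) > 0" and v: "v \<in> Pi\<^sub>E (N - {r}) X"
  shows "average X N J p (elem_gamble X N r g v) \<in> ind_prod X J D"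
proof (cases "r \<in> J")
  case True
  have "restrict v (J - {r}) \<in> Pi\<^sub>E (J - {r}) X" using v \<open>J \<subseteq> N\<close> by (auto simp: PiE_iff)
  then have "elem_gamble X J r g (restrict v (J - {r})) \<in> ind_prod X J D"
    using True g unfolding ind_prod_eq_posi_generators
    by (intro posi_base elem_gamble_in_generators)
  moreover have "(\<Prod>n\<in>N - J. p n (v n)) > 0"
    using v True by (intro prod_pos) (auto intro!: p simp: PiE_iff)
  ultimately have "(\<lambda>y. (\<Prod>n\<in>N - J. p n (v n)) *
      elem_gamble X J r g (restrict v (J - {r})) y) \<in> ind_prod X J D"
    unfolding ind_prod_eq_posi_generators by (rule posi_scale)
  moreover have "average X N J p (elem_gamble X N r g v) = (\<lambda>y. (\<Prod>n\<in>N - J. p n (v n)) *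
      elem_gamble X J r g (restrict v (J - {r})) y)"
    by (rule average_elem_gamble_inside) (use assms True in auto)
  ultimately show ?thesis by simp
next
  case False
  then have r': "r \<in> N - J" using r by simp
  have w: "(\<Prod>n\<in>N - J - {r}. p n (v n)) > 0"
    using v by (intro prod_pos) (auto intro!: p simp: PiE_iff)
  have "restrict v J \<in> Pi\<^sub>E J X" using v False \<open>J \<subseteq> N\<close> by (auto simp: PiE_iff)
  moreover have "average X N J p (elem_gamble X N r g v) y = 0" if "y \<notin> Pi\<^sub>E J X" for y
    using that by (simp add: average_def)
  moreover note avg = average_elem_gamble_outside[OF assms(1-3) r' v, of _ p g]
  moreover have "0 \<le> average X N J p (elem_gamble X N r g v) y" for y
    using w g(2) avg[of y] by (cases "y \<in> Pi\<^sub>E J X") (auto simp: average_def)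
  ultimately have "average X N J p (elem_gamble X N r g v) \<in> pos_gambles (Pi\<^sub>E J X)"
    unfolding pos_gambles_iff using w g(2) by (auto intro!: bexI[of _ "restrict v J"])
  then show ?thesis
    unfolding ind_prod_eq_posi_generators by (intro posi_base) (simp add: generators_def)
qed

section \<open>Choice of the weights and the converse inclusion\<close>

lemma ex_weights:
  assumes "\<And>n. n \<in> N \<Longrightarrow> finite (X n)" "\<And>n. n \<in> N \<Longrightarrow> coherent (X n) (D n)"
    and B: "finite B" "B \<subseteq> generators X N D"
  obtains p where "\<And>n a. n \<in> N \<Longrightarrow> a \<in> X n \<Longrightarrow> p n a > 0"
    and "\<And>b. b \<in> B \<Longrightarrow> b \<in> pos_gambles (Pi\<^sub>E N X) \<or>
      (\<exists>r g v. r \<in> N \<and> g \<in> D r \<and> v \<in> Pi\<^sub>E (N - {r}) X \<and> b = elem_gamble X N r g v \<and>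
        (\<Sum>a\<in>X r. p r a * g a) > 0)"
proof -
  define E where "E r = (\<lambda>(g, y). elem_gamble X N r g y) ` (D r \<times> Pi\<^sub>E (N - {r}) X)" for r
  define Q where "Q n q \<longleftrightarrow> (\<forall>a\<in>X n. q a > 0) \<and>
      (\<forall>b\<in>B \<inter> E n. \<exists>g v. g \<in> D n \<and> v \<in> Pi\<^sub>E (N - {n}) X \<and>
        b = elem_gamble X N n g v \<and> (\<Sum>a\<in>X n. q a * g a) > 0)" for n q
  have "\<forall>n\<in>N. \<exists>q. Q n q"
  proof
    fix n assume n: "n \<in> N"
    \<comment> \<open>Elements of \<open>B\<close> are gambles on the whole product, whereas weights
      on \<open>X n\<close> concern their factors \<open>g\<close>. \<open>C\<close> is a finite set
      of pairs \<open>(g, y)\<close> representing the elementary gambles for index \<open>n\<close>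
      in \<open>B\<close>.\<close>
    obtain C where C: "finite C" "C \<subseteq> D n \<times> Pi\<^sub>E (N - {n}) X"
        "B \<inter> E n = (\<lambda>(g, y). elem_gamble X N n g y) ` C"
      using finite_subset_image[of "B \<inter> E n"] B(1) unfolding E_def
      by (metis finite_Int inf_le2)
    then have "finite (fst ` C)" "fst ` C \<subseteq> D n" by auto
    then obtain q where "\<forall>a\<in>X n. q a > 0" "\<forall>g\<in>fst ` C. (\<Sum>a\<in>X n. q a * g a) > 0"
      using coherent_positive_weights[OF assms(2)[OF n] assms(1)[OF n]] by blast
    then show "\<exists>q. Q n q"
      using C(2) unfolding Q_def C(3) by (intro exI[of _ q]) fastforce
  qed
  then obtain p where p: "\<forall>n\<in>N. Q n (p n)"
    by (rule bchoice[THEN exE])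
  show thesis
  proof (rule that[of p])
    show "p n a > 0" if "n \<in> N" "a \<in> X n" for n a
      using bspec[OF p that(1)] that(2) by (simp add: Q_def)
    fix b assume b: "b \<in> B"
    have gen: "\<exists>g v. g \<in> D r \<and> v \<in> Pi\<^sub>E (N - {r}) X \<and> b = elem_gamble X N r g v \<and>
        (\<Sum>a\<in>X r. p r a * g a) > 0" if "r \<in> N" "b \<in> E r" for r
      using bspec[OF p that(1)] that(2) b unfolding Q_def by blast
    have "b \<in> pos_gambles (Pi\<^sub>E N X) \<union> (\<Union>r\<in>N. E r)"
      using b B(2) unfolding generators_def E_def by (rule subsetD[rotated])
    then show "b \<in> pos_gambles (Pi\<^sub>E N X) \<or>
        (\<exists>r g v. r \<in> N \<and> g \<in> D r \<and> v \<in> Pi\<^sub>E (N - {r}) X \<and> b = elem_gamble X N r g v \<and>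
          (\<Sum>a\<in>X r. p r a * g a) > 0)"
      using gen by blast
  qed
qed

lemma in_ind_prod_if_cond_cyl:
  assumes "finite N" and X: "\<And>n. n \<in> N \<Longrightarrow> finite (X n) \<and> X n \<noteq> {}"
    and "\<And>n. n \<in> N \<Longrightarrow> coherent (X n) (D n)"
    and IJ: "I \<subseteq> N" "J \<subseteq> N" "I \<inter> J = {}" and xI: "xI \<in> Pi\<^sub>E I X"
    and f: "f \<in> gambles (Pi\<^sub>E J X)" "cond_cyl X N I J xI f \<in> ind_prod X N D"
  shows "f \<in> ind_prod X J D"
proof -
  have finX: "\<And>n. n \<in> N \<Longrightarrow> finite (X n)" using X by blast
  obtain B where B: "finite B" "B \<subseteq> generators X N D" "cond_cyl X N I J xI f \<in> posi B"
    using f(2) posi_finite_support unfolding ind_prod_eq_posi_generators by blast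
  obtain p where p: "\<And>n a. n \<in> N \<Longrightarrow> a \<in> X n \<Longrightarrow> p n a > 0"
    and pB: "\<And>b. b \<in> B \<Longrightarrow> b \<in> pos_gambles (Pi\<^sub>E N X) \<or>
      (\<exists>r g v. r \<in> N \<and> g \<in> D r \<and> v \<in> Pi\<^sub>E (N - {r}) X \<and> b = elem_gamble X N r g v \<and>
        (\<Sum>a\<in>X r. p r a * g a) > 0)"
    by (rule ex_weights[OF finX assms(3) B(1,2)]) blast+
  \<comment> \<open>The factor from \<open>average_cond_cyl\<close>: the total weight of the points
    outside \<open>J\<close> that agree with \<open>xI\<close>.\<close>
  define c where
    "c = (\<Sum>z\<in>Pi\<^sub>E (N - J) X. if restrict z I = xI then \<Prod>n\<in>N - J. p n (z n) else 0)"
  have "average X N J p (cond_cyl X N I J xI f) \<in> ind_prod X J D"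
    using B(3)
  proof (induction rule: posi_induct)
    case (base b)
    from pB[OF base] show ?case
    proof
      assume "b \<in> pos_gambles (Pi\<^sub>E N X)"
      then have "average X N J p b \<in> pos_gambles (Pi\<^sub>E J X)"
        using average_pos_gamble[of N X J p b] assms(1) finX IJ(2) p by blast
      then show ?thesis
        unfolding ind_prod_eq_posi_generators by (intro posi_base) (simp add: generators_def)
    next
      assume "\<exists>r g v. r \<in> N \<and> g \<in> D r \<and> v \<in> Pi\<^sub>E (N - {r}) X \<and> b = elem_gamble X N r g v \<and>
        (\<Sum>a\<in>X r. p r a * g a) > 0"
      then show ?thesis
        using average_elem_gamble_in_ind_prod[of N X J p] assms(1) finX IJ(2) p by blast
    qed
  qed (auto simp: average_add average_scale ind_prod_eq_posi_generators intro: posi_add posi_scale)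
  then have avg: "(\<lambda>y. c * f y) \<in> posi (generators X J D)"
    using average_cond_cyl[OF IJ f(1), of p xI] by (simp add: c_def ind_prod_eq_posi_generators)
  \<comment> \<open>No term is negative, and a point over \<open>N - J\<close> extending
    \<open>xI\<close> contributes a positive one.\<close>
  have "c > 0"
  proof -
    have w: "(\<Prod>n\<in>N - J. p n (z n)) > 0" if "z \<in> Pi\<^sub>E (N - J) X" for z
      using that by (intro prod_pos) (auto intro: p)
    have "I \<subseteq> N - J" using IJ by blast
    then obtain z where z: "z \<in> Pi\<^sub>E (N - J) X" "restrict z I = xI"
      using ex_PiE_extending[of "N - J" X I "{}" xI "\<lambda>_. undefined"] X IJ xI by auto
    show ?thesis
      unfolding c_def
    proof (rule sum_pos2[of _ z])
      show "finite (Pi\<^sub>E (N - J) X)" using assms(1) finX by (intro finite_PiE) auto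
    qed (use z w in \<open>auto intro: less_imp_le\<close>)
  qed
  then show ?thesis
    using posi_scale[OF avg, of "inverse c"]
    by (simp add: ind_prod_eq_posi_generators mult.assoc[symmetric])
qed

section \<open>Equality of conditional and unconditional marginals\<close>

theorem proposition18:
  fixes N :: "'n set"
    and X :: "'n \<Rightarrow> 'a set"
    and D :: "'n \<Rightarrow> ('a \<Rightarrow> real) set"
  assumes "finite N" and "N \<noteq> {}"
    and "\<And>n. n \<in> N \<Longrightarrow> finite (X n) \<and> X n \<noteq> {}"
    and "\<And>n. n \<in> N \<Longrightarrow> coherent (X n) (D n)"
  shows "\<forall>I J xI. I \<subseteq> N \<longrightarrow> J \<subseteq> N \<longrightarrow> I \<inter> J = {} \<longrightarrow> xI \<in> Pi\<^sub>E I X \<longrightarrow>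
    marg X (N - I) J (cond X N I (ind_prod X N D) xI) = marg X N J (ind_prod X N D) \<and>
    marg X N J (ind_prod X N D) = ind_prod X J D"
proof (intro allI impI)
  fix I J xI
  assume IJ: "I \<subseteq> N" "J \<subseteq> N" "I \<inter> J = {}" and xI: "xI \<in> Pi\<^sub>E I X"
  \<comment> \<open>Applied with \<open>K = I\<close> for the conditional marginal and with
    \<open>K = {}\<close>, whose only point is \<open>\<lambda>_. undefined\<close>, for the
    unconditional one.\<close>
  have key: "f \<in> gambles (Pi\<^sub>E J X) \<and> cond_cyl X N K J xK f \<in> ind_prod X N D \<longleftrightarrow>
      f \<in> ind_prod X J D"
    if "K \<subseteq> N" "K \<inter> J = {}" "xK \<in> Pi\<^sub>E K X" for f K xK
    using in_ind_prod_if_cond_cyl[of N X D K J xK f] cond_cyl_in_ind_prod[of N X K J xK f D]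
      ind_prod_subset_gambles[of X J D] assms(1,3,4) that IJ(2) by blast
  have "marg X (N - I) J (cond X N I (ind_prod X N D) xI) = ind_prod X J D"
    using key[OF IJ(1,3) xI] by (auto simp: marg_cond_iff[OF IJ])
  moreover have "marg X N J (ind_prod X N D) = ind_prod X J D"
    using key[of "{}" "\<lambda>_. undefined"] by (auto simp: marg_iff)
  ultimately show "marg X (N - I) J (cond X N I (ind_prod X N D) xI) = marg X N J (ind_prod X N D) \<and>
      marg X N J (ind_prod X N D) = ind_prod X J D"
    by simp
qed

end
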